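(* Let $\mathcal E_1=(Z_1,\sigma_1,\kappa_1)$ and $\mathcal E_2=(Z_2,\sigma_2,\kappa_2)$ be weighted dual skeletons. Their disjoint union $\mathcal E_1\sqcup\mathcal E_2$ is a weighted dual skeleton if and only if $\deg(\mathcal E_1)=\deg(\mathcal E_2)$. In that case, the degree of $\mathcal E_1\sqcup\mathcal E_2$ is the common degree $K$, and its orbit ratios are those of each component.
   Context: A weighted dual skeleton is a triple $\mathcal E=(Z,\sigma,\kappa)$ where $Z$ is a non-empty finite set, $\sigma:Z\to Z$ satisfies $\sigma^2=\mathrm{id}$, and $\kappa:Z\to\mathbb R_{>0}$ satisfies $\kappa(z)\kappa(\sigma(z))=K$ for all $z\in Z$, with $K>0$ constant (independent of $z$); $K=\deg(\mathcal E)$ is the degree. The orbit ratio at $z$ is $r_z=(\kappa(\sigma(z))/\kappa(z))^{1/2}$. The disjoint union is the triple $\mathcal E_1\sqcup\mathcal E_2=(Z_1\sqcup Z_2,\sigma_1\sqcup\sigma_2,\kappa_1\sqcup\kappa_2)$, where the involution acts as $\sigma_i$ and the weight equals $\kappa_i$ on $Z_i$. *)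

theory Defs
  imports Complex_Main "HOL-Library.FuncSet"
begin

text \<open>
  The maps \<open>invol\<close> and \<open>weight\<close> are total functions in HOL, but only their values on
  the finite set \<open>points\<close> are relevant; all conditions are relativised to it.
\<close>

record 'a skeleton =
  points :: "'a set"
  invol :: "'a \<Rightarrow> 'a"
  weight :: "'a \<Rightarrow> real"

definition weighted_dual_skeleton :: "'a skeleton \<Rightarrow> bool" where
  "weighted_dual_skeleton E \<longleftrightarrow>
     finite (points E) \<and> points E \<noteq> {} \<and>
     invol E \<in> points E \<rightarrow> points E \<and>
     (\<forall>z\<in>points E. invol E (invol E z) = z) \<and>
     (\<forall>z\<in>points E. weight E z > 0) \<and>
     (\<exists>K>0. \<forall>z\<in>points E. weight E z * weight E (invol E z) = K)"

text \<open>The constant is unique since \<open>points E\<close> is non-empty.\<close>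

definition degree :: "'a skeleton \<Rightarrow> real" where
  "degree E = (THE K. \<forall>z\<in>points E. weight E z * weight E (invol E z) = K)"

definition orbit_ratio :: "'a skeleton \<Rightarrow> 'a \<Rightarrow> real" where
  "orbit_ratio E z = sqrt (weight E (invol E z) / weight E z)"

definition disjoint_union :: "'a skeleton \<Rightarrow> 'b skeleton \<Rightarrow> ('a + 'b) skeleton" where
  "disjoint_union E1 E2 =
     \<lparr> points = points E1 <+> points E2,
       invol = map_sum (invol E1) (invol E2),
       weight = case_sum (weight E1) (weight E2) \<rparr>"

end

theory Submission
  imports Defs
begin

text \<open>
  Neither the involution nor the weight of a disjoint union mixes its summands. Hence
  the pointwise conditions on the union hold iff they hold on each summand; this includes the
  equations \<open>\<kappa>(z) \<kappa>(\<sigma>(z)) = K\<close>. The summands are coupled only in that a single \<open>K\<close> must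
  serve all points: since the summands are non-empty, each forces \<open>K\<close> to be its own degree, so a
  common constant exists iff the degrees agree. Orbit ratios depend only on a point and its image
  under the involution, and both lie in the same summand.
\<close>

lemma degree_eqI:
  assumes "points E \<noteq> {}"
    and "\<And>z. z \<in> points E \<Longrightarrow> weight E z * weight E (invol E z) = K"
  shows "degree E = K"
  unfolding degree_def using assms by (intro the_equality) auto

lemma weight_product_eq_degree:
  assumes "weighted_dual_skeleton E" and "z \<in> points E"
  shows "weight E z * weight E (invol E z) = degree E"
proof -
  obtain K where K: "\<forall>z\<in>points E. weight E z * weight E (invol E z) = K"
    using assms(1) unfolding weighted_dual_skeleton_def by blast
  have "degree E = K"
    using K assms(2) by (intro degree_eqI) auto
  with K assms(2) show ?thesis by simp
qed

lemma degree_pos: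
  assumes "weighted_dual_skeleton E"
  shows "degree E > 0"
proof -
  obtain z where "z \<in> points E"
    using assms unfolding weighted_dual_skeleton_def by blast
  moreover obtain K where "K > 0" "\<forall>z\<in>points E. weight E z * weight E (invol E z) = K"
    using assms unfolding weighted_dual_skeleton_def by blast
  ultimately show ?thesis
    using weight_product_eq_degree[OF assms] by metis
qed

lemma disjoint_union_simps [simp]:
  "points (disjoint_union E1 E2) = points E1 <+> points E2"
  "invol (disjoint_union E1 E2) (Inl x) = Inl (invol E1 x)"
  "invol (disjoint_union E1 E2) (Inr y) = Inr (invol E2 y)"
  "weight (disjoint_union E1 E2) (Inl x) = weight E1 x"
  "weight (disjoint_union E1 E2) (Inr y) = weight E2 y"
  by (simp_all add: disjoint_union_def)

lemma orbit_ratio_disjoint_union: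
  "orbit_ratio (disjoint_union E1 E2) (Inl x) = orbit_ratio E1 x"
  "orbit_ratio (disjoint_union E1 E2) (Inr y) = orbit_ratio E2 y"
  by (simp_all add: orbit_ratio_def)

text \<open>
  The constant of the union is attained at the points of each summand, and there it can only be
  the degree of that summand. This is where non-emptiness matters: an empty summand would put
  no constraint on the constant.
\<close>

lemma degree_disjoint_union:
  assumes E1: "weighted_dual_skeleton E1" and E2: "weighted_dual_skeleton E2"
    and U: "weighted_dual_skeleton (disjoint_union E1 E2)"
  shows "degree (disjoint_union E1 E2) = degree E1"
    and "degree (disjoint_union E1 E2) = degree E2"
proof -
  obtain x y where x: "x \<in> points E1" and y: "y \<in> points E2"
    using E1 E2 unfolding weighted_dual_skeleton_def by blast
  show "degree (disjoint_union E1 E2) = degree E1"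
    using weight_product_eq_degree[OF U, of "Inl x"] weight_product_eq_degree[OF E1 x] x by (simp add: InlI)
  show "degree (disjoint_union E1 E2) = degree E2"
    using weight_product_eq_degree[OF U, of "Inr y"] weight_product_eq_degree[OF E2 y] y by (simp add: InrI)
qed

lemma weighted_dual_skeleton_disjoint_union:
  assumes E1: "weighted_dual_skeleton E1" and E2: "weighted_dual_skeleton E2"
    and deg: "degree E1 = degree E2"
  shows "weighted_dual_skeleton (disjoint_union E1 E2)"
proof -
  let ?U = "disjoint_union E1 E2"
  have "\<forall>z\<in>points ?U. weight ?U z * weight ?U (invol ?U z) = degree E1"
    using weight_product_eq_degree[OF E1] weight_product_eq_degree[OF E2] deg by auto
  then have "\<exists>K>0. \<forall>z\<in>points ?U. weight ?U z * weight ?U (invol ?U z) = K"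
    using degree_pos[OF E1] by blast
  moreover have "finite (points ?U)" and "points ?U \<noteq> {}"
    and "invol ?U \<in> points ?U \<rightarrow> points ?U"
    and "\<forall>z\<in>points ?U. invol ?U (invol ?U z) = z"
    and "\<forall>z\<in>points ?U. weight ?U z > 0"
    using E1 E2 unfolding weighted_dual_skeleton_def by auto
  ultimately show ?thesis
    unfolding weighted_dual_skeleton_def by blast
qed

theorem proposition4p4:
  fixes E1 :: "'a skeleton" and E2 :: "'b skeleton"
  assumes "weighted_dual_skeleton E1" and "weighted_dual_skeleton E2"
  shows "(weighted_dual_skeleton (disjoint_union E1 E2) \<longleftrightarrow> degree E1 = degree E2) \<and>
    (weighted_dual_skeleton (disjoint_union E1 E2) \<longrightarrow>
       degree (disjoint_union E1 E2) = degree E1 \<and>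
       degree (disjoint_union E1 E2) = degree E2 \<and>
       (\<forall>z\<in>points E1. orbit_ratio (disjoint_union E1 E2) (Inl z) = orbit_ratio E1 z) \<and>
       (\<forall>z\<in>points E2. orbit_ratio (disjoint_union E1 E2) (Inr z) = orbit_ratio E2 z))"
  using weighted_dual_skeleton_disjoint_union[OF assms] degree_disjoint_union[OF assms]
  by (auto simp: orbit_ratio_disjoint_union)

end
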